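(* Let $(E,\mathrm{dep})$ be a DSC and define $V:P(E)\to P(E)$ by $V(X)=\bigcup_{x\in X}\mathrm{Vers}(x)$, where $\mathrm{Vers}(x)=\{e'\in E: x\blacktriangleleft e'\}$. Then $V$ restricts to a function $V:\mathsf{rdp}(E)\to\mathsf{rdp}(E)$, and this is a closure operator.
   Context: $P(A)$ denotes the power set of $A$. A preDSC is a pair $(E,\mathrm{dep})$ with $E$ a finite set and $\mathrm{dep}:E\to P(P(E))$ a function; elements of $\mathrm{dep}(e)$ are called depsets of $e$. For $X,Y\subseteq E$ write $X\,\mathrm{rch}\,Y$ if $X\subseteq Y$ and for every $y\in Y$ there is $D\in\mathrm{dep}(y)$ with $D\subseteq X$. A subset $X\subseteq E$ is reachable if there is a finite sequence of subsets with $\varnothing\,\mathrm{rch}\,X_0\,\mathrm{rch}\cdots\mathrm{rch}\,X_n\,\mathrm{rch}\,X$. $\mathsf{rdp}(E)$ is the poset of reachable subsets ordered by inclusion. A subset $X$ is complete if every $e\in X$ has a depset $D\in\mathrm{dep}(e)$ with $D\subseteq X$. A DSC is a preDSC which is irredundant ($D_0\subseteq D_1$ with $D_0,D_1\in\mathrm{dep}(e)$ implies $D_0=D_1$), acyclic ($e\notin D$ for all $D\in\mathrm{dep}(e)$), nonsingular ($\mathrm{dep}(e)\neq\varnothing$ for all $e$) and has complete depsets (all $D\in\mathrm{dep}(e)$ are complete). Higher version relation on a DSC: $e\blacktriangleleft e'$ if (1) for every $D\in\mathrm{dep}(e)$ there is $D'\in\mathrm{dep}(e')$ with $D'\subseteq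 D$; and (2) for every $x\in E$ and $D\in\mathrm{dep}(x)$ with $e\in D$, one has $(D\setminus\{e\})\cup\{e'\}\in\mathrm{dep}(x)$. A closure operator on a poset $P$ is an order-preserving function $f:P\to P$ with $p\le f(p)$ and $f(f(p))=f(p)$ for all $p\in P$. *)

theory Defs
  imports Main
begin

locale preDSC =
  fixes E :: "'a set" and dep :: "'a \<Rightarrow> 'a set set"
  assumes finite_E: "finite E"
    and dep_subset: "\<And>e. e \<in> E \<Longrightarrow> dep e \<subseteq> Pow E"

text \<open>
  The values of \<^term>\<open>dep\<close> outside \<^term>\<open>E\<close> are irrelevant: every notion below only refers to
  \<^term>\<open>dep e\<close> for \<^term>\<open>e \<in> E\<close>.
\<close>

definition rch :: "'a set \<Rightarrow> ('a \<Rightarrow> 'a set set) \<Rightarrow> 'a set \<Rightarrow> 'a set \<Rightarrow> bool" where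
  "rch E dep X Y \<longleftrightarrow> X \<subseteq> E \<and> Y \<subseteq> E \<and> X \<subseteq> Y \<and> (\<forall>y\<in>Y. \<exists>D\<in>dep y. D \<subseteq> X)"

definition reachable :: "'a set \<Rightarrow> ('a \<Rightarrow> 'a set set) \<Rightarrow> 'a set \<Rightarrow> bool" where
  "reachable E dep X \<longleftrightarrow> X \<subseteq> E \<and>
    (\<exists>(n::nat) S. rch E dep {} (S 0) \<and> (\<forall>i<n. rch E dep (S i) (S (Suc i))) \<and> rch E dep (S n) X)"

text \<open>The order on \<open>rdp\<close> is inclusion, i.e. the order of type \<^typ>\<open>'a set\<close>.\<close>

definition rdp :: "'a set \<Rightarrow> ('a \<Rightarrow> 'a set set) \<Rightarrow> 'a set set" where
  "rdp E dep = {X. reachable E dep X}"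

definition complete_set :: "'a set \<Rightarrow> ('a \<Rightarrow> 'a set set) \<Rightarrow> 'a set \<Rightarrow> bool" where
  "complete_set E dep X \<longleftrightarrow> X \<subseteq> E \<and> (\<forall>e\<in>X. \<exists>D\<in>dep e. D \<subseteq> X)"

locale DSC = preDSC +
  assumes irredundant:
      "\<And>e D0 D1. e \<in> E \<Longrightarrow> D0 \<in> dep e \<Longrightarrow> D1 \<in> dep e \<Longrightarrow> D0 \<subseteq> D1 \<Longrightarrow> D0 = D1"
    and acyclic: "\<And>e D. e \<in> E \<Longrightarrow> D \<in> dep e \<Longrightarrow> e \<notin> D"
    and nonsingular: "\<And>e. e \<in> E \<Longrightarrow> dep e \<noteq> {}"
    and complete_depsets: "\<And>e D. e \<in> E \<Longrightarrow> D \<in> dep e \<Longrightarrow> complete_set E dep D"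

definition higher_version :: "'a set \<Rightarrow> ('a \<Rightarrow> 'a set set) \<Rightarrow> 'a \<Rightarrow> 'a \<Rightarrow> bool" where
  "higher_version E dep e e' \<longleftrightarrow> e \<in> E \<and> e' \<in> E \<and>
    (\<forall>D\<in>dep e. \<exists>D'\<in>dep e'. D' \<subseteq> D) \<and>
    (\<forall>x\<in>E. \<forall>D\<in>dep x. e \<in> D \<longrightarrow> (D - {e}) \<union> {e'} \<in> dep x)"

definition Vers :: "'a set \<Rightarrow> ('a \<Rightarrow> 'a set set) \<Rightarrow> 'a \<Rightarrow> 'a set" where
  "Vers E dep x = {e' \<in> E. higher_version E dep x e'}"

definition V :: "'a set \<Rightarrow> ('a \<Rightarrow> 'a set set) \<Rightarrow> 'a set \<Rightarrow> 'a set" where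
  "V E dep X = (\<Union>x\<in>X. Vers E dep x)"

lemma V_subset: "V E dep X \<subseteq> E"
  by (auto simp: V_def Vers_def)

text \<open>A poset is given here as a subset \<^term>\<open>P\<close> of a partially ordered type, with the induced order.\<close>

definition closure_operator_on :: "'b::order set \<Rightarrow> ('b \<Rightarrow> 'b) \<Rightarrow> bool" where
  "closure_operator_on P f \<longleftrightarrow>
    f ` P \<subseteq> P \<and> mono_on P f \<and> (\<forall>p\<in>P. p \<le> f p \<and> f (f p) = f p)"

end

theory Submission
  imports Defs
begin

text \<open>
  The higher version relation is a preorder on a DSC, and \<open>V X\<close> is the upward closure of \<open>X\<close> in it:
  this gives monotonicity, extensivity and idempotence at once. Only transitivity needs an argument,
  and it comes from irredundancy (\<open>higher_version_trans\<close>).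

  That \<open>V\<close> preserves reachability holds because \<open>V\<close> maps every step of a reachability chain to a step
  (\<open>rch_V\<close>): a higher version \<open>y'\<close> of \<open>y\<close> has a depset below each depset of \<open>y\<close>, so it becomes
  available no later than \<open>y\<close>. Since \<open>V {} = {}\<close>, the image of a chain that starts at the empty set
  is again such a chain.
\<close>

lemma higher_version_refl: "e \<in> E \<Longrightarrow> higher_version E dep e e"
  by (auto simp: higher_version_def insert_absorb)

text \<open>
  The composite of two replacements \<open>e \<mapsto> e'\<close> and \<open>e' \<mapsto> e''\<close> in a depset \<open>D\<close> could also lose a copy of
  \<open>e'\<close> that was already in \<open>D\<close>. Irredundancy excludes this: if \<open>e \<noteq> e'\<close> both lay in \<open>D\<close>, the first
  replacement would give a depset properly contained in \<open>D\<close>.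
\<close>

lemma (in DSC) higher_version_trans:
  assumes "higher_version E dep e e'" and "higher_version E dep e' e''"
  shows "higher_version E dep e e''"
  unfolding higher_version_def
proof (intro conjI ballI impI)
  show "e \<in> E" "e'' \<in> E"
    using assms by (auto simp: higher_version_def)
next
  fix D assume "D \<in> dep e"
  then obtain D' where "D' \<in> dep e'" "D' \<subseteq> D"
    using assms(1) by (auto simp: higher_version_def)
  moreover from \<open>D' \<in> dep e'\<close> obtain D'' where "D'' \<in> dep e''" "D'' \<subseteq> D'"
    using assms(2) by (auto simp: higher_version_def)
  ultimately show "\<exists>D''\<in>dep e''. D'' \<subseteq> D" by blast
next
  fix x D assume x: "x \<in> E" and D: "D \<in> dep x" and e: "e \<in> D"
  let ?D1 = "(D - {e}) \<union> {e'}"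
  have D1: "?D1 \<in> dep x"
    using assms(1) x D e unfolding higher_version_def by blast
  have D2: "(?D1 - {e'}) \<union> {e''} \<in> dep x"
    using assms(2) x D1 unfolding higher_version_def by blast
  have "e' \<notin> D - {e}"
  proof
    assume e': "e' \<in> D - {e}"
    then have "?D1 = D"
      using irredundant[OF x D1 D] by blast
    with e e' show False by blast
  qed
  then have "?D1 - {e'} = D - {e}" by blast
  with D2 show "(D - {e}) \<union> {e''} \<in> dep x" by simp
qed

lemma V_mono: "X \<subseteq> Y \<Longrightarrow> V E dep X \<subseteq> V E dep Y"
  by (auto simp: V_def)

lemma V_extensive: "X \<subseteq> E \<Longrightarrow> X \<subseteq> V E dep X"
  by (auto simp: V_def Vers_def intro: higher_version_refl)

lemma (in DSC) V_idem: "V E dep (V E dep X) = V E dep X"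
proof
  show "V E dep (V E dep X) \<subseteq> V E dep X"
    by (auto simp: V_def Vers_def intro: higher_version_trans)
  show "V E dep X \<subseteq> V E dep (V E dep X)"
    by (rule V_extensive[OF V_subset])
qed

lemma rch_V:
  assumes "rch E dep X Y"
  shows "rch E dep (V E dep X) (V E dep Y)"
  unfolding rch_def
proof (intro conjI ballI)
  show "V E dep X \<subseteq> V E dep Y"
    using assms by (intro V_mono) (simp add: rch_def)
next
  fix y' assume "y' \<in> V E dep Y"
  then obtain y where y: "y \<in> Y" and hv: "higher_version E dep y y'"
    by (auto simp: V_def Vers_def)
  obtain D where "D \<in> dep y" "D \<subseteq> X"
    using assms y by (auto simp: rch_def)
  moreover from \<open>D \<in> dep y\<close> obtain D' where "D' \<in> dep y'" "D' \<subseteq> D"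
    using hv by (auto simp: higher_version_def)
  moreover have "X \<subseteq> V E dep X"
    using assms by (intro V_extensive) (simp add: rch_def)
  ultimately show "\<exists>D'\<in>dep y'. D' \<subseteq> V E dep X" by blast
qed (rule V_subset)+

lemma reachable_V:
  assumes "reachable E dep X"
  shows "reachable E dep (V E dep X)"
proof -
  obtain n :: nat and S where S: "rch E dep {} (S 0)"
      "\<And>i. i < n \<Longrightarrow> rch E dep (S i) (S (Suc i))" "rch E dep (S n) X"
    using assms by (auto simp: reachable_def)
  have "rch E dep {} (V E dep (S 0))"
    using rch_V[OF S(1)] by (simp add: V_def)
  with S(2,3) show ?thesis
    unfolding reachable_def
    by (intro conjI exI[of _ n] exI[of _ "\<lambda>i. V E dep (S i)"]) (auto intro: rch_V V_subset[THEN subsetD])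
qed

theorem corollary8p6:
  fixes E :: "'a set" and dep :: "'a \<Rightarrow> 'a set set"
  assumes "DSC E dep"
  shows "V E dep ` rdp E dep \<subseteq> rdp E dep \<and> closure_operator_on (rdp E dep) (V E dep)"
proof -
  interpret DSC E dep by (rule assms)
  have "V E dep ` rdp E dep \<subseteq> rdp E dep"
    by (auto simp: rdp_def intro: reachable_V)
  moreover have "X \<subseteq> V E dep X" if "X \<in> rdp E dep" for X
    using that by (intro V_extensive) (simp add: rdp_def reachable_def)
  ultimately show ?thesis
    by (auto simp: closure_operator_on_def V_idem intro!: mono_onI dest: V_mono[THEN subsetD])
qed

end
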